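(* Let $H\in C^{1}(\mathbb{R}^{4})$ and $E\in\mathbb{R}$, and let $\Sigma_E^{\mathrm{sec}}$, $\pi_E\colon\Sigma_E^{\mathrm{sec}}\to\mathbb{R}^2$, $\mathrm{Crit}(\pi_E)$ and $D_E$ be the section energy set, its projection, the critical locus and the discriminant, as defined in the context. (a) On $\Sigma_E^{\mathrm{sec}}\setminus\mathrm{Crit}(\pi_E)$ the map $\pi_E$ is a local diffeomorphism. (b) If the coercivity condition (C) holds, then $\pi_E$ is proper. (c) If (C) holds, then the restriction of $\pi_E$ over $\mathbb{R}^2\setminus D_E$, i.e. $\pi_E\colon\pi_E^{-1}(\mathbb{R}^2\setminus D_E)\to\mathbb{R}^2\setminus D_E$, is a covering map of locally constant multiplicity (multiplicity $0$ allowed), equal on each connected component of $\mathbb{R}^2\setminus D_E$ to the number of real roots $p_1$ of $H(0,q_2,p_1,p_2)=E$ for $(q_2,p_2)$ in that component.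
   Context: Coordinates on $\mathbb{R}^4$ are $(q_1,q_2,p_1,p_2)$. Let $C=\{q_1=0\}$, identified with $\mathbb{R}^3$ with coordinates $(q_2,p_1,p_2)$. The reduced space is $\mathbb{R}^2$ with coordinates $b=(q_2,p_2)$, and $\pi\colon C\to\mathbb{R}^2$, $\pi(0,q_2,p_1,p_2)=(q_2,p_2)$. For $b=(q_2,p_2)$ the fibre function is $h_b(p_1)=H(0,q_2,p_1,p_2)$. Put $\Sigma_E^{\mathrm{sec}}=\{H=E\}\cap C=\{(q_2,p_1,p_2): h_{b}(p_1)=E\}$ and $\pi_E=\pi|_{\Sigma_E^{\mathrm{sec}}}$. The critical locus is $\mathrm{Crit}(\pi_E)=\{x\in\Sigma_E^{\mathrm{sec}}:\partial_{p_1}H(x)=0\}$ and the discriminant is $D_E=\pi_E(\mathrm{Crit}(\pi_E))$. Condition (C) (coercivity): $h_b(p_1)\to+\infty$ as $|p_1|\to\infty$, locally uniformly in $b$; that is, every $b_0\in\mathbb{R}^2$ has a neighbourhood $N$ such that for every $M$ there is $R$ with $h_b(p_1)>M$ for all $b\in N$ and $|p_1|>R$. *)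

theory Defs
  imports "HOL-Analysis.Analysis"
begin

definition C1_on :: "'a::real_normed_vector set \<Rightarrow> ('a \<Rightarrow> 'b::real_normed_vector) \<Rightarrow> bool" where
  "C1_on U f \<longleftrightarrow> open U \<and>
     (\<exists>f' :: 'a \<Rightarrow> ('a \<Rightarrow>\<^sub>L 'b).
        (\<forall>x\<in>U. (f has_derivative blinfun_apply (f' x)) (at x)) \<and> continuous_on U f')"

text \<open>On an arbitrary subset \<open>S\<close> of a normed space, \<open>C\<^sup>1\<close> means: locally the restriction of a
  \<open>C\<^sup>1\<close> map of the ambient space. On an embedded submanifold this is the
  usual notion for the induced structure. Accordingly, a local diffeomorphism from \<open>S\<close> to an open
  subset of \<open>\<real>\<^sup>n\<close> exhibits \<open>S\<close> as an embedded \<open>n\<close>-dimensional \<open>C\<^sup>1\<close> submanifold.\<close>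

definition C1_map :: "'a::real_normed_vector set \<Rightarrow> ('a \<Rightarrow> 'b::real_normed_vector) \<Rightarrow> bool" where
  "C1_map S f \<longleftrightarrow> (\<forall>x\<in>S. \<exists>U g. x \<in> U \<and> C1_on U g \<and> (\<forall>y\<in>S \<inter> U. g y = f y))"

definition C1_diffeomorphism ::
    "'a::real_normed_vector set \<Rightarrow> 'b::real_normed_vector set \<Rightarrow> ('a \<Rightarrow> 'b) \<Rightarrow> bool" where
  "C1_diffeomorphism S T f \<longleftrightarrow> (\<exists>g. homeomorphism S T f g \<and> C1_map S f \<and> C1_map T g)"

definition C1_local_diffeomorphism ::
    "'a::real_normed_vector set \<Rightarrow> 'b::real_normed_vector set \<Rightarrow> ('a \<Rightarrow> 'b) \<Rightarrow> bool" where
  "C1_local_diffeomorphism S T f \<longleftrightarrow>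
     (\<forall>x\<in>S. \<exists>U. x \<in> U \<and> openin (top_of_set S) U \<and> openin (top_of_set T) (f ` U) \<and>
        C1_diffeomorphism U (f ` U) f)"

text \<open>The library's \<^const>\<open>covering_space\<close> requires the projection to be surjective. Here the
  number of sheets over a point may be \<open>0\<close>, so surjectivity is dropped; the number
  of sheets over \<open>x\<close> is finite and recorded as \<open>m x\<close>.\<close>

definition covering_map_with_multiplicity ::
    "'a::topological_space set \<Rightarrow> ('a \<Rightarrow> 'b::topological_space) \<Rightarrow> 'b set \<Rightarrow> ('b \<Rightarrow> nat) \<Rightarrow> bool" where
  "covering_map_with_multiplicity c p S m \<longleftrightarrow>
     continuous_on c p \<and> p ` c \<subseteq> S \<and>
     (\<forall>x\<in>S. \<exists>T. x \<in> T \<and> openin (top_of_set S) T \<and>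
        (\<exists>v. \<Union>v = c \<inter> p -` T \<and>
             (\<forall>u\<in>v. openin (top_of_set c) u) \<and>
             pairwise disjnt v \<and>
             (\<forall>u\<in>v. \<exists>q. homeomorphism u T p q) \<and>
             finite v \<and> card v = m x))"

lemma covering_map_with_multiplicity_imp_covering_space:
  assumes "covering_map_with_multiplicity c p S m" and "p ` c = S"
  shows "covering_space c p S"
  using assms unfolding covering_map_with_multiplicity_def covering_space_def by meson

lemma proper_map_iff_compact_preimage:
  fixes f :: "'a::metric_space \<Rightarrow> 'b::euclidean_space"
  assumes "continuous_on S f"
  shows "proper_map (top_of_set S) euclidean f \<longleftrightarrow>
           (\<forall>K. compact K \<longrightarrow> compact (S \<inter> f -` K))"
proof -
  have k: "k_space (euclidean :: 'b topology)" "kc_space (euclidean :: 'b topology)"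
    by (auto intro!: metrizable_imp_k_space Hausdorff_imp_kc_space
        simp: metrizable_space_euclidean)
  have eq: "{x \<in> S. f x \<in> K} = S \<inter> f -` K" for K by auto
  have c: "continuous_map (top_of_set S) euclidean f \<or> kc_space (top_of_set S)"
    using assms by simp
  show ?thesis
    by (subst proper_eq_compact_map [OF k c]) (auto simp: eq compactin_subtopology)
qed

definition fibre_fun :: "(real \<times> real \<times> real \<times> real \<Rightarrow> real) \<Rightarrow> real \<times> real \<Rightarrow> real \<Rightarrow> real" where
  "fibre_fun H = (\<lambda>(q2, p2) p1. H (0, q2, p1, p2))"

text \<open>The section \<open>{q\<^sub>1 = 0}\<close> of \<open>\<real>\<^sup>4\<close> is identified with \<open>\<real>\<^sup>3\<close>, with
  coordinates \<open>(q\<^sub>2, p\<^sub>1, p\<^sub>2)\<close>.\<close>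

definition Sigma_sec :: "(real \<times> real \<times> real \<times> real \<Rightarrow> real) \<Rightarrow> real \<Rightarrow> (real \<times> real \<times> real) set" where
  "Sigma_sec H E = {(q2, p1, p2). H (0, q2, p1, p2) = E}"

definition proj :: "real \<times> real \<times> real \<Rightarrow> real \<times> real" where
  "proj = (\<lambda>(q2, p1, p2). (q2, p2))"

definition Crit :: "(real \<times> real \<times> real \<times> real \<Rightarrow> real) \<Rightarrow> real \<Rightarrow> (real \<times> real \<times> real) set" where
  "Crit H E = {(q2, p1, p2). (q2, p1, p2) \<in> Sigma_sec H E \<and> deriv (\<lambda>t. H (0, q2, t, p2)) p1 = 0}"

definition discriminant :: "(real \<times> real \<times> real \<times> real \<Rightarrow> real) \<Rightarrow> real \<Rightarrow> (real \<times> real) set" where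
  "discriminant H E = proj ` Crit H E"

definition coercive :: "(real \<times> real \<times> real \<times> real \<Rightarrow> real) \<Rightarrow> bool" where
  "coercive H \<longleftrightarrow>
     (\<forall>b0. \<exists>N. open N \<and> b0 \<in> N \<and>
        (\<forall>M. \<exists>R. \<forall>b\<in>N. \<forall>p1. \<bar>p1\<bar> > R \<longrightarrow> fibre_fun H b p1 > M))"

end

theory Submission
  imports Defs
begin

text \<open>Away from the critical locus the map \<open>(q\<^sub>2, p\<^sub>1, p\<^sub>2) \<mapsto> (q\<^sub>2, H (0, q\<^sub>2, p\<^sub>1, p\<^sub>2), p\<^sub>2)\<close> is a
  local diffeomorphism, so the energy section is locally the graph of a \<open>C\<^sup>1\<close> function
  of \<open>(q\<^sub>2, p\<^sub>2)\<close>. Coercivity bounds \<open>p\<^sub>1\<close> over compact sets, which makes the projection proper. A proper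
  local homeomorphism is a finite covering: its fibres are compact and discrete, and, the projection
  being closed, all points over a small neighbourhood of \<open>b\<close> lie near the fibre over \<open>b\<close>.\<close>

section \<open>The implicit function theorem for a level set\<close>

text \<open>The inverse function theorem applies to
  \<open>F (a, t, c) = (a, G (a, t, c), c)\<close>, whose derivative at \<open>x0\<close> is
  invertible because the middle partial derivative is nonzero there. Restricting the local inverse
  to middle coordinate \<open>E\<close> parametrises the level set. Nonvanishing of the partial
  derivative on all of \<open>U\<close> is recorded so that the graph later contains only
  noncritical points.\<close>

lemma level_set_local_graph:
  fixes G :: "real \<times> real \<times> real \<Rightarrow> real" and G' :: "real \<times> real \<times> real \<Rightarrow> (real \<times> real \<times> real) \<Rightarrow>\<^sub>L real"
  assumes der: "\<And>x. (G has_derivative blinfun_apply (G' x)) (at x)"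
    and cont: "continuous_on UNIV G'"
    and x0: "G x0 = E" "G' x0 (0, 1, 0) \<noteq> 0"
  obtains U W \<phi> where "open U" "x0 \<in> U" "\<And>x. x \<in> U \<Longrightarrow> G' x (0, 1, 0) \<noteq> 0" "open W" "C1_on W \<phi>"
    "{x. G x = E} \<inter> U = (\<lambda>b. (fst b, \<phi> b, snd b)) ` W"
proof -
  define U0 where "U0 = {x. G' x (0, 1, 0) \<noteq> 0}"
  define F where "F = (\<lambda>x::real \<times> real \<times> real. (fst x, G x, snd (snd x)))"
  define L where "L = Blinfun (\<lambda>x::real \<times> real \<times> real. (fst x, 0::real, snd (snd x)))"
  define K where "K = Blinfun (\<lambda>t::real. (0::real, t, 0::real))"
  define P where "P = Blinfun (\<lambda>x::real \<times> real \<times> real. fst (snd x))"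
  define J where "J = Blinfun (\<lambda>b::real \<times> real. (fst b, 0::real, snd b))"
  define F' where "F' = (\<lambda>x. L + (K o\<^sub>L G' x))"
  define d where "d = G' x0 (0, 1, 0)"
  \<comment> \<open>Solving \<open>F' x0 v = (a, s, c)\<close> keeps \<open>a\<close> and
    \<open>c\<close> and gives the middle component
    \<open>(s - G' x0 (a, 0, c)) / d\<close>.\<close>
  define invf where "invf = L + (1/d) *\<^sub>R (K o\<^sub>L (P - (G' x0 o\<^sub>L L)))"
  have L: "blinfun_apply L = (\<lambda>x. (fst x, 0, snd (snd x)))"
    unfolding L_def by (intro bounded_linear_Blinfun_apply bounded_linear_intros)
  have K: "blinfun_apply K = (\<lambda>t. (0, t, 0))"
    unfolding K_def by (intro bounded_linear_Blinfun_apply bounded_linear_intros)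
  have P: "blinfun_apply P = (\<lambda>x. fst (snd x))"
    unfolding P_def by (intro bounded_linear_Blinfun_apply bounded_linear_intros)
  have J: "blinfun_apply J = (\<lambda>b. (fst b, 0, snd b))"
    unfolding J_def by (intro bounded_linear_Blinfun_apply bounded_linear_intros)
  have split: "A (a, t, c) = A (a, 0, c) + t * A (0, 1, 0)"
    for A :: "(real \<times> real \<times> real) \<Rightarrow>\<^sub>L real" and a t c
  proof -
    have "(a, t, c) = (a, 0, c) + t *\<^sub>R (0::real, 1::real, 0::real)" by simp
    then show ?thesis by (simp only: blinfun.add_right blinfun.scaleR_right real_scaleR_def)
  qed
  have "continuous_on UNIV (\<lambda>x. G' x (0, 1, 0))"
    by (intro continuous_intros cont)
  then have U0: "open U0"
    unfolding U0_def by (intro open_Collect_neq continuous_on_const)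
  have dF: "(F has_derivative blinfun_apply (F' x)) (at x)" for x
    unfolding F_def F'_def
    by (auto intro!: derivative_eq_intros der simp: blinfun.add_left L K)
  have cF: "continuous_on U0 F'"
    unfolding F'_def by (intro continuous_intros continuous_on_subset[OF cont] subset_UNIV)
  have inv: "invf o\<^sub>L F' x0 = id_blinfun"
  proof (rule blinfun_eqI)
    fix x :: "real \<times> real \<times> real"
    obtain a t c where x: "x = (a, t, c)" by (cases x)
    show "(invf o\<^sub>L F' x0) x = id_blinfun x"
      using x0(2) split[of "G' x0" a t c]
      by (simp add: x invf_def F'_def blinfun.add_left blinfun.diff_left blinfun.scaleR_left
          L K P d_def)
  qed
  have x0_in: "x0 \<in> U0" using x0 by (simp add: U0_def)
  obtain U V g g' where U: "open U" "U \<subseteq> U0" "x0 \<in> U" and V: "open V" "F x0 \<in> V"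
    and hom: "homeomorphism U V F g"
    and dg: "\<And>y. y \<in> V \<Longrightarrow> (g has_derivative (g' y)) (at y)"
    using inverse_function_theorem[OF U0 dF cF x0_in inv] by metis
  \<comment> \<open>\<open>N\<close> embeds the base as the plane of middle coordinate
    \<open>E\<close>; \<open>W\<close> is the part of that plane lying in the domain of the local
    inverse.\<close>
  define N where "N = (\<lambda>b::real \<times> real. (fst b, E, snd b))"
  define W where "W = N -` V"
  define \<phi> where "\<phi> = (\<lambda>b. fst (snd (g (N b))))"
  define s where "s = (\<lambda>b. (fst b, \<phi> b, snd b))"
  \<comment> \<open>This is the derivative obtained by implicit differentiation of
    \<open>G (s b) = E\<close>. In this form its continuity follows from that of \<open>G'\<close>
    and \<open>\<phi>\<close>.\<close>
  define \<phi>' where "\<phi>' = (\<lambda>b. (- 1 / G' (s b) (0, 1, 0)) *\<^sub>R (G' (s b) o\<^sub>L J))"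
  have W: "open W"
    unfolding W_def N_def by (intro open_vimage V continuous_intros)
  have s: "s b \<in> U" "G (s b) = E" if "b \<in> W" for b
  proof -
    have "F (g (N b)) = N b" "g (N b) \<in> U"
      using that homeomorphism_apply2[OF hom] homeomorphism_image2[OF hom] by (auto simp: W_def)
    then have "g (N b) = s b \<and> G (s b) = E"
      by (cases "g (N b)") (auto simp: F_def N_def s_def \<phi>_def)
    with \<open>g (N b) \<in> U\<close> show "s b \<in> U" "G (s b) = E" by auto
  qed
  \<comment> \<open>Differentiability comes first, from \<open>\<phi>\<close> being a component of
    \<open>g\<close> composed with \<open>N\<close>; the formula for the derivative is identified
    afterwards.\<close>
  have ex: "\<exists>D. (\<phi> has_derivative D) (at b)" if "b \<in> W" for b
  proof -
    have "(N has_derivative (\<lambda>v. (fst v, 0, snd v))) (at b)"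
      unfolding N_def by (auto intro!: derivative_eq_intros)
    moreover have "(g has_derivative g' (N b)) (at (N b))"
      using that by (auto simp: W_def intro: dg)
    ultimately have "((\<lambda>b. g (N b)) has_derivative (\<lambda>v. g' (N b) (fst v, 0, snd v))) (at b)"
      by (rule has_derivative_compose)
    then show ?thesis
      unfolding \<phi>_def by (intro exI) (rule has_derivative_fst, rule has_derivative_snd)
  qed
  \<comment> \<open>The composite of \<open>G\<close> with \<open>s\<close> is constantly
    \<open>E\<close> on the open set \<open>W\<close>, so its chain-rule derivative vanishes;
    \<open>split\<close> isolates the term in \<open>D v\<close>, and the equation is solved for
    it.\<close>
  have d\<phi>: "(\<phi> has_derivative blinfun_apply (\<phi>' b)) (at b)" if b: "b \<in> W" for b
  proof -
    obtain D where D: "(\<phi> has_derivative D) (at b)" using ex[OF b] by blast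
    have "(s has_derivative (\<lambda>v. (fst v, D v, snd v))) (at b)"
      unfolding s_def by (auto intro!: derivative_eq_intros D)
    then have "((\<lambda>b. G (s b)) has_derivative (\<lambda>v. G' (s b) (fst v, D v, snd v))) (at b)"
      by (rule has_derivative_compose) (rule der)
    moreover have "((\<lambda>b. G (s b)) has_derivative (\<lambda>v. 0)) (at b)"
      by (rule has_derivative_transform_within_open[OF has_derivative_const W b]) (simp add: s)
    ultimately have "(\<lambda>v. G' (s b) (fst v, D v, snd v)) = (\<lambda>v. 0)"
      by (rule has_derivative_unique)
    then have 0: "G' (s b) (fst v, 0, snd v) + D v * G' (s b) (0, 1, 0) = 0" for v
      by (metis split)
    have "G' (s b) (0, 1, 0) \<noteq> 0"
      using s(1)[OF b] U(2) by (auto simp: U0_def)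
    then have "D v = \<phi>' b v" for v
      using 0[of v] by (simp add: \<phi>'_def blinfun.scaleR_left blinfun.minus_left J field_simps)
    then have "D = blinfun_apply (\<phi>' b)" by blast
    then show ?thesis using D by simp
  qed
  have c\<phi>: "continuous_on W \<phi>"
    using d\<phi> has_derivative_continuous by (blast intro: continuous_at_imp_continuous_on)
  have cs: "continuous_on W s"
    unfolding s_def by (intro continuous_intros c\<phi>)
  have cG: "continuous_on W (\<lambda>b. G' (s b))"
    by (rule continuous_on_compose2[OF cont cs]) auto
  have "continuous_on W \<phi>'"
    unfolding \<phi>'_def using s(1) U(2)
    by (intro continuous_intros cG)
       (auto simp: U0_def)
  then have "C1_on W \<phi>"
    unfolding C1_on_def using W d\<phi> by blast
  moreover have "{x. G x = E} \<inter> U = s ` W"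
  proof
    show "s ` W \<subseteq> {x. G x = E} \<inter> U" using s by auto
    show "{x. G x = E} \<inter> U \<subseteq> s ` W"
    proof
      fix x assume x: "x \<in> {x. G x = E} \<inter> U"
      define b where "b = (fst x, snd (snd x))"
      have Nb: "N b = F x" using x by (auto simp: b_def N_def F_def)
      then have "b \<in> W"
        using x homeomorphism_image1[OF hom] by (auto simp: W_def)
      moreover have "s b = x"
        using x homeomorphism_apply1[OF hom] by (simp add: s_def \<phi>_def Nb) (simp add: b_def)
      ultimately show "x \<in> s ` W" by blast
    qed
  qed
  moreover have "G' x (0, 1, 0) \<noteq> 0" if "x \<in> U" for x
    using that U(2) by (auto simp: U0_def)
  ultimately show thesis
    using that[OF U(1,3) _ W] unfolding s_def by blast
qed

section \<open>Sheets, fibres and multiplicity of a covering\<close>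

text \<open>Each sheet is mapped homeomorphically onto \<open>T\<close> and so meets the fibre over
  \<open>y\<close> in exactly one point; disjointness makes points from different sheets
  distinct.\<close>

lemma bij_betw_sheets_fibre:
  assumes cover: "\<Union>v = c \<inter> p -` T" and disj: "pairwise disjnt v"
    and hom: "\<forall>u\<in>v. \<exists>q. homeomorphism u T p q" and y: "y \<in> T"
  obtains f where "bij_betw f v (c \<inter> p -` {y})"
proof -
  obtain q where q: "\<And>u. u \<in> v \<Longrightarrow> homeomorphism u T p (q u)"
    using hom by metis
  have 1: "q u y \<in> u" "p (q u y) = y" if "u \<in> v" for u
    using q[OF that] y by (auto simp: homeomorphism_def)
  have "bij_betw (\<lambda>u. q u y) v (c \<inter> p -` {y})"
  proof (rule bij_betw_imageI)
    show "inj_on (\<lambda>u. q u y) v"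
      using disj 1(1) unfolding inj_on_def pairwise_def disjnt_def by (metis IntI empty_iff)
    show "(\<lambda>u. q u y) ` v = c \<inter> p -` {y}"
    proof
      show "(\<lambda>u. q u y) ` v \<subseteq> c \<inter> p -` {y}"
        using 1 cover by blast
      show "c \<inter> p -` {y} \<subseteq> (\<lambda>u. q u y) ` v"
      proof
        fix x assume x: "x \<in> c \<inter> p -` {y}"
        then obtain u where u: "u \<in> v" "x \<in> u" using cover y by blast
        then have "q u y = x"
          using homeomorphism_apply1[OF q] x by fastforce
        then show "x \<in> (\<lambda>u. q u y) ` v" using u by blast
      qed
    qed
  qed
  then show thesis by (rule that)
qed

lemma covering_map_with_multiplicityE:
  assumes m: "covering_map_with_multiplicity c p S m" and x: "x \<in> S"
  obtains T v where "x \<in> T" "openin (top_of_set S) T" "\<Union>v = c \<inter> p -` T"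
    "\<forall>u\<in>v. openin (top_of_set c) u" "pairwise disjnt v"
    "\<forall>u\<in>v. \<exists>q. homeomorphism u T p q" "finite v" "card v = m x"
  using bspec[OF conjunct2[OF conjunct2[OF m[unfolded covering_map_with_multiplicity_def]]] x]
  by (elim exE conjE) (rule that)

text \<open>The bijection between sheets and fibre, taken at the base point \<open>x\<close>, shows
  that on \<open>S\<close> the function \<open>m\<close> is determined by the map itself.\<close>

lemma covering_map_with_multiplicity_fibre:
  assumes "covering_map_with_multiplicity c p S m" "x \<in> S"
  shows "finite (c \<inter> p -` {x})" "card (c \<inter> p -` {x}) = m x"
proof -
  obtain T v where T: "x \<in> T" "\<Union>v = c \<inter> p -` T" "pairwise disjnt v"
      "\<forall>u\<in>v. \<exists>q. homeomorphism u T p q" "finite v" "card v = m x"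
    using assms by (rule covering_map_with_multiplicityE)
  obtain f where f: "bij_betw f v (c \<inter> p -` {x})"
    using bij_betw_sheets_fibre[OF T(2,3,4,1)] .
  show "finite (c \<inter> p -` {x})" "card (c \<inter> p -` {x}) = m x"
    using bij_betw_finite[OF f] bij_betw_same_card[OF f] T(5,6) by auto
qed

text \<open>The definition counts sheets only at the chosen point \<open>x\<close>, but the same
  family \<open>v\<close> is in bijection with the fibre over every \<open>y\<close> in
  \<open>T\<close>, and the size of that fibre is \<open>m y\<close>.\<close>

lemma covering_map_with_multiplicity_locally_constant:
  assumes m: "covering_map_with_multiplicity c p S m" and x: "x \<in> S"
  shows "\<exists>T. openin (top_of_set S) T \<and> x \<in> T \<and> (\<forall>y\<in>T. m y = m x)"
proof -
  obtain T v where T: "openin (top_of_set S) T" "x \<in> T" "\<Union>v = c \<inter> p -` T" "pairwise disjnt v"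
      "\<forall>u\<in>v. \<exists>q. homeomorphism u T p q" "card v = m x"
    using assms by (rule covering_map_with_multiplicityE)
  have "m y = m x" if y: "y \<in> T" for y
  proof -
    obtain f where f: "bij_betw f v (c \<inter> p -` {y})"
      using bij_betw_sheets_fibre[OF T(3,4,5) y] .
    have "y \<in> S" using openin_imp_subset[OF T(1)] y by blast
    then show ?thesis
      using bij_betw_same_card[OF f] covering_map_with_multiplicity_fibre(2)[OF m] T(6) by metis
  qed
  with T(1,2) show ?thesis by blast
qed

section \<open>Proper local homeomorphisms are finite coverings\<close>

text \<open>Properness enters twice: compactness of a fibre makes it finite, and closedness of
  \<open>p\<close> keeps the image of points far from the fibre away from \<open>b\<close>. Local
  inverses are assumed only over \<open>S\<close>, so that \<open>p\<close> may fold
  elsewhere.\<close>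

lemma covering_map_with_multiplicity_proper_local_homeomorphism:
  fixes p :: "'a::metric_space \<Rightarrow> 'b::metric_space"
  assumes cont: "continuous_on X p"
    and proper: "proper_map (top_of_set X) euclidean p"
    and loc: "\<And>x. x \<in> X \<Longrightarrow> p x \<in> S \<Longrightarrow>
      \<exists>U g. x \<in> U \<and> openin (top_of_set X) U \<and> open (p ` U) \<and> homeomorphism U (p ` U) p g"
  shows "covering_map_with_multiplicity (X \<inter> p -` S) p S (\<lambda>b. card (X \<inter> p -` {b}))"
proof -
  have "\<exists>T. b \<in> T \<and> openin (top_of_set S) T \<and>
        (\<exists>v. \<Union>v = X \<inter> p -` S \<inter> p -` T \<and>
             (\<forall>u\<in>v. openin (top_of_set (X \<inter> p -` S)) u) \<and>
             pairwise disjnt v \<and>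
             (\<forall>u\<in>v. \<exists>q. homeomorphism u T p q) \<and>
             finite v \<and> card v = card (X \<inter> p -` {b}))" if b: "b \<in> S" for b
  proof -
    define Q where "Q = X \<inter> p -` {b}"
    have "compactin (top_of_set X) {x \<in> X. p x = b}"
      using proper by (simp add: proper_map_def)
    moreover have "{x \<in> X. p x = b} = Q" by (auto simp: Q_def)
    ultimately have Q: "compact Q" by (simp add: compactin_subtopology)
    have "\<forall>x\<in>Q. \<exists>U g. x \<in> U \<and> openin (top_of_set X) U \<and> open (p ` U) \<and> homeomorphism U (p ` U) p g"
      using loc b by (auto simp: Q_def)
    then obtain U g where U: "\<And>x. x \<in> Q \<Longrightarrow> x \<in> U x" "\<And>x. x \<in> Q \<Longrightarrow> openin (top_of_set X) (U x)"
        "\<And>x. x \<in> Q \<Longrightarrow> open (p ` U x)" "\<And>x. x \<in> Q \<Longrightarrow> homeomorphism (U x) (p ` U x) p (g x)"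
      by metis
    have UX: "U x \<subseteq> X" if "x \<in> Q" for x
      using openin_imp_subset[OF U(2)[OF that]] .
    have gp: "g x (p y) = y" if "x \<in> Q" "y \<in> U x" for x y
      using homeomorphism_apply1[OF U(4)] that by blast
    have pg: "p (g x b') = b'" "g x b' \<in> U x" if "x \<in> Q" "b' \<in> p ` U x" for x b'
      using homeomorphism_apply2[OF U(4)] homeomorphism_image2[OF U(4)] that by blast+
    have gb: "g x b = x" if "x \<in> Q" for x
      using gp[OF that U(1)[OF that]] that by (simp add: Q_def)
    \<comment> \<open>Injectivity of \<open>p\<close> on \<open>U x\<close> makes \<open>x\<close>
      the only fibre point in it, so the fibre is discrete.\<close>
    have UQ: "y = x" if "x \<in> Q" "y \<in> Q" "y \<in> U x" for x y
      using gp[OF that(1,3)] gb[OF that(1)] that(2) by (simp add: Q_def)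
    \<comment> \<open>A finite subcover by sets with one fibre point each exhausts the
      fibre.\<close>
    have fin: "finite Q"
    proof -
      have "\<forall>x\<in>Q. \<exists>O'. open O' \<and> U x = X \<inter> O'"
        using U(2) by (simp add: openin_open)
      then obtain O' where O': "\<And>x. x \<in> Q \<Longrightarrow> open (O' x)" "\<And>x. x \<in> Q \<Longrightarrow> U x = X \<inter> O' x" by metis
      obtain C where C: "C \<subseteq> Q" "finite C" "Q \<subseteq> (\<Union>x\<in>C. O' x)"
      proof (rule compactE_image[OF Q, of Q O'])
        show "Q \<subseteq> (\<Union>x\<in>Q. O' x)" using O'(2) U(1) by blast
      qed (use O'(1) in auto)
      have "Q \<subseteq> C"
      proof
        fix y assume y: "y \<in> Q"
        then obtain x where x: "x \<in> C" "y \<in> O' x" using C by blast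
        then have "y \<in> U x" using O'(2)[of x] C(1) y by (auto simp: Q_def)
        then show "y \<in> C" using UQ[of x y] x C(1) y by blast
      qed
      then show ?thesis using C finite_subset by blast
    qed
    \<comment> \<open>\<open>C\<close> collects the points outside all chosen neighbourhoods. Its
      image is closed and misses \<open>b\<close>.\<close>
    define C where "C = X - (\<Union>x\<in>Q. U x)"
    have "closedin (top_of_set X) C"
      unfolding C_def by (intro closedin_diff closedin_subtopology_refl[THEN iffD2] openin_Union) (auto intro: U(2))
    then have "closed (p ` C)"
      using proper by (auto simp: proper_map_def closed_map_def)
    \<comment> \<open>On \<open>Z x y\<close> the local sections through \<open>x\<close> and \<open>y\<close> differ. Removing \<open>p ` C\<close> leaves no
      points outside the sheets.\<close>
    define Z where "Z = (\<lambda>x y. (p ` U x \<inter> p ` U y) \<inter> (\<lambda>b. dist (g x b) (g y b)) -` {0<..})"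
    have Z: "open (Z x y)" if "x \<in> Q" "y \<in> Q" for x y
      unfolding Z_def
    proof (intro continuous_open_preimage continuous_on_dist)
      show "continuous_on (p ` U x \<inter> p ` U y) (g x)" "continuous_on (p ` U x \<inter> p ` U y) (g y)"
        using U(4) that by (auto simp: homeomorphism_def intro: continuous_on_subset)
    qed (use U(3) that in auto)
    define V where "V = (\<Inter>x\<in>Q. p ` U x) \<inter> (\<Inter>x\<in>Q. \<Inter>y\<in>Q - {x}. Z x y) - p ` C"
    have V: "open V"
      unfolding V_def using fin \<open>closed (p ` C)\<close> U(3) Z
      by (intro open_Diff open_Int open_INT) auto
    have VU: "b' \<in> p ` U x" if "b' \<in> V" "x \<in> Q" for b' x
      using that by (auto simp: V_def)
    have Vne: "g x b' \<noteq> g y b'" if "b' \<in> V" "x \<in> Q" "y \<in> Q" "x \<noteq> y" for b' x y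
      using that by (fastforce simp: V_def Z_def)
    have bU: "b \<in> p ` U x" if "x \<in> Q" for x
      using U(1)[OF that] that by (force simp: Q_def)
    have bV: "b \<in> V"
    proof -
      have "b \<notin> p ` C" using U(1) by (auto simp: C_def Q_def)
      then show ?thesis using bU gb by (auto simp: V_def Z_def)
    qed
    define T where "T = S \<inter> V"
    define v where "v = (\<lambda>x. g x ` T) ` Q"
    \<comment> \<open>The left side shows a sheet as the image of a section; the right side shows
      that it is relatively open.\<close>
    have sheet: "g x ` T = X \<inter> p -` S \<inter> (U x \<inter> (X \<inter> p -` V))" if x: "x \<in> Q" for x
    proof
      show "g x ` T \<subseteq> X \<inter> p -` S \<inter> (U x \<inter> (X \<inter> p -` V))"
        using pg[OF x] VU[OF _ x] UX[OF x] by (auto simp: T_def)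
      show "X \<inter> p -` S \<inter> (U x \<inter> (X \<inter> p -` V)) \<subseteq> g x ` T"
        using gp[OF x] by (force simp: T_def)
    qed
    have bT: "b \<in> T" using b bV by (simp add: T_def)
    have "\<Union>v = X \<inter> p -` S \<inter> p -` T"
    proof
      show "\<Union>v \<subseteq> X \<inter> p -` S \<inter> p -` T"
        using sheet by (auto simp: v_def T_def)
      show "X \<inter> p -` S \<inter> p -` T \<subseteq> \<Union>v"
      proof
        fix y assume y: "y \<in> X \<inter> p -` S \<inter> p -` T"
        then have "y \<notin> C" by (auto simp: T_def V_def)
        then obtain x where "x \<in> Q" "y \<in> U x" using y by (auto simp: C_def)
        then show "y \<in> \<Union>v" using y sheet by (auto simp: v_def T_def)
      qed
    qed
    moreover have "openin (top_of_set (X \<inter> p -` S)) u" if u: "u \<in> v" for u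
    proof -
      obtain x where x: "x \<in> Q" "u = g x ` T" using u by (auto simp: v_def)
      have "openin (top_of_set X) (U x \<inter> (X \<inter> p -` V))"
        using U(2)[OF x(1)] continuous_openin_preimage_gen[OF cont V] by (rule openin_Int)
      then show ?thesis
        unfolding x(2) sheet[OF x(1)] by (auto simp: openin_open)
    qed
    \<comment> \<open>A common point has a single projection, so \<open>b1 = b2\<close>, and over
      \<open>V\<close> the two sections differ at that point.\<close>
    moreover have dj: "disjnt (g x ` T) (g y ` T)" if "x \<in> Q" "y \<in> Q" "x \<noteq> y" for x y
    proof -
      have False if "b1 \<in> T" "b2 \<in> T" "g x b1 = g y b2" for b1 b2
      proof -
        have "b1 \<in> V" "b2 \<in> V" using that by (auto simp: T_def)
        then have "b1 = b2"
          using pg(1) VU \<open>x \<in> Q\<close> \<open>y \<in> Q\<close> that(3) by metis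
        then show False using Vne that \<open>b1 \<in> V\<close> \<open>x \<in> Q\<close> \<open>y \<in> Q\<close> \<open>x \<noteq> y\<close> by blast
      qed
      then show ?thesis by (auto simp: disjnt_def)
    qed
    have "pairwise disjnt v"
      unfolding pairwise_def v_def using dj by blast
    moreover have "\<exists>q. homeomorphism u T p q" if u: "u \<in> v" for u
    proof -
      obtain x where x: "x \<in> Q" "u = g x ` T" using u by (auto simp: v_def)
      have T: "T \<subseteq> p ` U x" using VU x by (auto simp: T_def)
      then have "p ` g x ` T = T" using pg(1)[OF x(1)] by (force simp: image_iff)
      moreover have "g x ` T \<subseteq> U x" unfolding sheet[OF x(1)] by blast
      ultimately have "homeomorphism (g x ` T) T p (g x)"
        using homeomorphism_of_subsets[OF U(4)[OF x(1)] _ T] by simp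
      then show ?thesis using x by blast
    qed
    \<comment> \<open>The sheets are nonempty because \<open>b\<close> is in \<open>T\<close>, so
      disjoint sheets are different sets and each fibre point contributes its own.\<close>
    moreover have "card v = card Q"
      unfolding v_def
    proof (rule card_image, rule inj_onI, rule ccontr)
      fix x y assume "x \<in> Q" "y \<in> Q" "g x ` T = g y ` T" "x \<noteq> y"
      then show False using dj[of x y] bT by (auto simp: disjnt_def)
    qed
    ultimately show ?thesis
      using bT fin V by (intro exI[of _ T] conjI exI[of _ v]) (auto simp: T_def Q_def v_def)
  qed
  then show ?thesis
    unfolding covering_map_with_multiplicity_def
    using continuous_on_subset[OF cont] by auto
qed

section \<open>Regularity of the energy section and its critical locus\<close>

lemma Sigma_sec_eq: "Sigma_sec H E = {x. H (0, x) = E}"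
  by (auto simp: Sigma_sec_def)

lemma proj_eq: "proj = (\<lambda>x. (fst x, snd (snd x)))"
  by (auto simp: proj_def)

lemma continuous_on_proj: "continuous_on S proj"
  unfolding proj_eq by (intro continuous_intros)

lemma C1_on_imp_continuous_on:
  assumes "C1_on U f"
  shows "continuous_on U f"
proof (rule continuous_at_imp_continuous_on, rule ballI)
  fix x assume "x \<in> U"
  then obtain f' where "(f has_derivative f') (at x)"
    using assms unfolding C1_on_def by blast
  then show "isCont f x" by (rule has_derivative_continuous)
qed

lemma closed_Sigma_sec:
  assumes "C1_on UNIV H"
  shows "closed (Sigma_sec H E)"
proof -
  have "continuous_on UNIV (\<lambda>x. H (0, x))"
    by (intro continuous_on_compose2[OF C1_on_imp_continuous_on[OF assms]] continuous_intros) auto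
  then show ?thesis
    unfolding Sigma_sec_eq by (intro closed_Collect_eq continuous_on_const)
qed

text \<open>The chain rule along the inclusion \<open>x \<mapsto> (0, x)\<close> moves the problem
  to three coordinates. The one-variable \<open>deriv\<close> in \<open>Crit\<close> becomes the
  value of the total derivative on \<open>(0, 1, 0)\<close>, which depends continuously on the
  point.\<close>

lemma section_derivative:
  assumes "C1_on UNIV H"
  obtains G' :: "real \<times> real \<times> real \<Rightarrow> (real \<times> real \<times> real) \<Rightarrow>\<^sub>L real"
  where "\<And>x. ((\<lambda>x. H (0, x)) has_derivative blinfun_apply (G' x)) (at x)" "continuous_on UNIV G'"
    "Crit H E = {x \<in> Sigma_sec H E. G' x (0, 1, 0) = 0}"
proof -
  obtain H' where H': "\<And>x. (H has_derivative blinfun_apply (H' x)) (at x)" "continuous_on UNIV H'"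
    using assms unfolding C1_on_def by blast
  define I where "I = Blinfun (\<lambda>x::real \<times> real \<times> real. (0::real, x))"
  have I: "blinfun_apply I = (\<lambda>x. (0, x))"
    unfolding I_def by (intro bounded_linear_Blinfun_apply bounded_linear_intros)
  define G' where "G' = (\<lambda>x. H' (0, x) o\<^sub>L I)"
  have dG: "((\<lambda>x. H (0, x)) has_derivative blinfun_apply (G' x)) (at x)" for x
  proof -
    have "((\<lambda>x. (0::real, x)) has_derivative (\<lambda>v. (0, v))) (at x)"
      by (auto intro!: derivative_eq_intros)
    from has_derivative_compose[OF this H'(1)] show ?thesis
      by (rule has_derivative_eq_rhs) (simp add: G'_def I fun_eq_iff)
  qed
  have cG: "continuous_on UNIV G'"
    unfolding G'_def by (intro continuous_intros continuous_on_compose2[OF H'(2)]) auto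
  have dp: "deriv (\<lambda>t. H (0, a, t, c)) p = G' (a, p, c) (0, 1, 0)" for a p c
  proof (rule DERIV_imp_deriv)
    have "((\<lambda>t. (a, t, c)) has_derivative (\<lambda>t. (0, t, 0))) (at p)"
      by (auto intro!: derivative_eq_intros)
    from has_derivative_compose[OF this dG]
    have D: "((\<lambda>t. H (0, a, t, c)) has_derivative (\<lambda>t. G' (a, p, c) (0, t, 0))) (at p)" .
    have eq: "G' (a, p, c) (0, t, 0) = G' (a, p, c) (0, 1, 0) * t" for t
    proof -
      have "(0::real, t, 0::real) = t *\<^sub>R (0, 1, 0)" by simp
      then show ?thesis by (simp only: blinfun.scaleR_right real_scaleR_def mult.commute)
    qed
    show "((\<lambda>t. H (0, a, t, c)) has_real_derivative G' (a, p, c) (0, 1, 0)) (at p)"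
      unfolding has_field_derivative_def using D by (rule has_derivative_eq_rhs) (rule ext, rule eq)
  qed
  have "Crit H E = {x \<in> Sigma_sec H E. G' x (0, 1, 0) = 0}"
    by (auto simp: Crit_def dp)
  with dG cG show thesis by (rule that)
qed

text \<open>Closedness makes the noncritical part open in the section, so neighbourhoods in the
  former are also neighbourhoods in the latter.\<close>

lemma closed_Crit:
  assumes "C1_on UNIV H"
  shows "closed (Crit H E)"
proof (rule section_derivative[OF assms, of E])
  fix G' :: "real \<times> real \<times> real \<Rightarrow> (real \<times> real \<times> real) \<Rightarrow>\<^sub>L real"
  assume G': "continuous_on UNIV G'" "Crit H E = {x \<in> Sigma_sec H E. G' x (0, 1, 0) = 0}"
  have "continuous_on UNIV (\<lambda>x. G' x (0, 1, 0))"
    by (intro continuous_intros G')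
  then have "closed {x. G' x (0, 1, 0) = 0}"
    by (intro closed_Collect_eq continuous_on_const)
  moreover have "Crit H E = Sigma_sec H E \<inter> {x. G' x (0, 1, 0) = 0}"
    by (auto simp: G'(2))
  ultimately show ?thesis
    using closed_Sigma_sec[OF assms] by auto
qed

lemma C1_on_imp_C1_map:
  assumes "C1_on U f" "S \<subseteq> U"
  shows "C1_map S f"
  unfolding C1_map_def using assms by (intro ballI exI[of _ U] exI[of _ f]) auto

lemma C1_on_bounded_linear:
  assumes "bounded_linear f"
  shows "C1_on UNIV f"
proof -
  have "(f has_derivative blinfun_apply (Blinfun f)) (at x)" for x
    unfolding bounded_linear_Blinfun_apply[OF assms] by (rule bounded_linear_imp_has_derivative[OF assms])
  then show ?thesis
    unfolding C1_on_def by (intro conjI exI[of _ "\<lambda>_. Blinfun f"] ballI open_UNIV continuous_on_const)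
qed

lemma C1_on_graph:
  fixes \<phi> :: "real \<times> real \<Rightarrow> real"
  assumes "C1_on W \<phi>"
  shows "C1_on W (\<lambda>b. (fst b, \<phi> b, snd b))"
proof -
  obtain \<phi>' where \<phi>': "open W" "\<And>b. b \<in> W \<Longrightarrow> (\<phi> has_derivative blinfun_apply (\<phi>' b)) (at b)"
      "continuous_on W \<phi>'"
    using assms unfolding C1_on_def by blast
  define J where "J = Blinfun (\<lambda>b::real \<times> real. (fst b, 0::real, snd b))"
  define K where "K = Blinfun (\<lambda>t::real. (0::real, t, 0::real))"
  have J: "blinfun_apply J = (\<lambda>b. (fst b, 0, snd b))"
    unfolding J_def by (intro bounded_linear_Blinfun_apply bounded_linear_intros)
  have K: "blinfun_apply K = (\<lambda>t. (0, t, 0))"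
    unfolding K_def by (intro bounded_linear_Blinfun_apply bounded_linear_intros)
  have "((\<lambda>b. (fst b, \<phi> b, snd b)) has_derivative blinfun_apply (J + (K o\<^sub>L \<phi>' b))) (at b)"
    if "b \<in> W" for b
    by (auto intro!: derivative_eq_intros \<phi>'(2) that simp: blinfun.add_left J K)
  moreover have "continuous_on W (\<lambda>b. J + (K o\<^sub>L \<phi>' b))"
    by (intro continuous_intros \<phi>'(3))
  ultimately show ?thesis
    unfolding C1_on_def using \<phi>'(1) by (intro conjI exI[of _ "\<lambda>b. J + (K o\<^sub>L \<phi>' b)"]) auto
qed

section \<open>The projection as a local diffeomorphism\<close>

text \<open>Near a noncritical point the section is a graph over an open set \<open>W\<close>, and
  the graph parametrisation \<open>s\<close> is a \<open>C\<^sup>1\<close> inverse of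
  \<open>proj\<close>.\<close>

lemma C1_local_diffeomorphism_proj:
  assumes "C1_on UNIV H"
  shows "C1_local_diffeomorphism (Sigma_sec H E - Crit H E) UNIV proj"
  unfolding C1_local_diffeomorphism_def
proof
  fix x assume x: "x \<in> Sigma_sec H E - Crit H E"
  obtain G' where G': "\<And>x. ((\<lambda>x. H (0, x)) has_derivative blinfun_apply (G' x)) (at x)"
      "continuous_on UNIV G'" "Crit H E = {x \<in> Sigma_sec H E. blinfun_apply (G' x) (0, 1, 0) = 0}"
    using section_derivative[OF assms, of E] by blast
  have x': "H (0, x) = E" "G' x (0, 1, 0) \<noteq> 0"
    using x by (auto simp: G'(3)) (auto simp: Sigma_sec_eq)
  obtain U W \<phi> where U: "open U" "x \<in> U" "\<And>x. x \<in> U \<Longrightarrow> G' x (0, 1, 0) \<noteq> 0" "open W" "C1_on W \<phi>"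
    and graph: "{x. H (0, x) = E} \<inter> U = (\<lambda>b. (fst b, \<phi> b, snd b)) ` W"
    using level_set_local_graph[OF G'(1,2) x'] by blast
  define s where "s = (\<lambda>b. (fst b, \<phi> b, snd b))"
  have gr: "Sigma_sec H E \<inter> U = s ` W"
    using graph by (simp add: Sigma_sec_eq s_def)
  have ps: "proj (s b) = b" for b by (simp add: proj_eq s_def)
  have W: "proj ` (s ` W) = W" by (simp add: image_image ps)
  have C1s: "C1_on W s" unfolding s_def by (rule C1_on_graph[OF U(5)])
  have "homeomorphism (s ` W) W proj s"
    using W by (intro homeomorphismI continuous_on_proj C1_on_imp_continuous_on[OF C1s]) (auto simp: ps)
  moreover have "C1_map (s ` W) proj"
    unfolding proj_eq by (intro C1_on_imp_C1_map[OF C1_on_bounded_linear] bounded_linear_intros subset_UNIV)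
  moreover have "C1_map W s" by (rule C1_on_imp_C1_map[OF C1s order_refl])
  ultimately have "C1_diffeomorphism (s ` W) (proj ` (s ` W)) proj"
    unfolding C1_diffeomorphism_def W by blast
  \<comment> \<open>Since \<open>U\<close> contains no critical points, removing
    \<open>Crit H E\<close> does not change the graph.\<close>
  moreover have "s ` W = (Sigma_sec H E - Crit H E) \<inter> U"
    using U(3) unfolding gr[symmetric] by (auto simp: G'(3))
  ultimately show "\<exists>U. x \<in> U \<and> openin (top_of_set (Sigma_sec H E - Crit H E)) U \<and>
      openin (top_of_set UNIV) (proj ` U) \<and> C1_diffeomorphism U (proj ` U) proj"
    using x U W by (intro exI[of _ "s ` W"]) (auto simp: openin_open)
qed

section \<open>Properness from coercivity\<close>

text \<open>Finitely many coercivity neighbourhoods cover a compact \<open>K\<close> and give one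
  bound on all roots over it. The preimage of \<open>K\<close> is then a closed subset of a compact
  box.\<close>

lemma proper_map_proj:
  assumes C1: "C1_on UNIV H" and coe: "coercive H"
  shows "proper_map (top_of_set (Sigma_sec H E)) euclidean proj"
  unfolding proper_map_iff_compact_preimage[OF continuous_on_proj]
proof (intro allI impI)
  fix K :: "(real \<times> real) set" assume K: "compact K"
  \<comment> \<open>Coercivity is taken at level \<open>M = E\<close>: a root of
    \<open>fibre_fun H b p1 = E\<close> with \<open>b\<close> in \<open>N\<close> then has absolute
    value at most \<open>R\<close>.\<close>
  have "\<forall>b0. \<exists>N R. open N \<and> b0 \<in> N \<and> (\<forall>b\<in>N. \<forall>p1. \<bar>p1\<bar> > R \<longrightarrow> fibre_fun H b p1 > E)"
    using coe unfolding coercive_def by metis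
  then obtain N R where N: "\<And>b. open (N b)" "\<And>b. b \<in> N b"
    and R: "\<And>b0 b p1. b \<in> N b0 \<Longrightarrow> \<bar>p1\<bar> > R b0 \<Longrightarrow> fibre_fun H b p1 > E"
    by metis
  obtain C where C: "C \<subseteq> K" "finite C" "K \<subseteq> (\<Union>b\<in>C. N b)"
    by (rule compactE_image[OF K, of K N]) (use N in auto)
  \<comment> \<open>Inserting \<open>0\<close> keeps the maximum meaningful when \<open>C\<close> is
    empty.\<close>
  define r where "r = Max (insert 0 (R ` C))"
  define B where "B = (\<lambda>x. (fst (fst x), snd x, snd (fst x))) ` (K \<times> {-r..r})"
  have "compact B"
    unfolding B_def by (intro compact_continuous_image continuous_intros compact_Times K compact_Icc)
  moreover have "Sigma_sec H E \<inter> proj -` K \<subseteq> B"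
  proof
    fix x assume x: "x \<in> Sigma_sec H E \<inter> proj -` K"
    obtain a p c where xe: "x = (a, p, c)" by (cases x)
    have h: "fibre_fun H (a, c) p = E" "(a, c) \<in> K"
      using x by (auto simp: xe fibre_fun_def Sigma_sec_def proj_def)
    obtain b0 where b0: "b0 \<in> C" "(a, c) \<in> N b0" using C h(2) by blast
    have "\<bar>p\<bar> \<le> R b0" using R[OF b0(2), of p] h(1) by linarith
    also have "R b0 \<le> r" unfolding r_def using C(2) b0(1) by (intro Max_ge) auto
    finally have "((a, c), p) \<in> K \<times> {-r..r}" using h(2) by auto
    then show "x \<in> B" unfolding B_def xe by (rule image_eqI[rotated]) simp
  qed
  moreover have "closed (Sigma_sec H E \<inter> proj -` K)"
    using closed_Sigma_sec[OF C1] continuous_on_proj[of UNIV] compact_imp_closed[OF K]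
    by (intro closed_Int) (auto simp: closed_vimage)
  ultimately show "compact (Sigma_sec H E \<inter> proj -` K)"
    by (metis compact_Int_closed inf.absorb_iff2)
qed

section \<open>The covering over the complement of the discriminant and its root count\<close>

lemma bij_betw_fibre_proj:
  "bij_betw (\<lambda>p. (q2, p, p2)) {p. H (0, q2, p, p2) = E} (Sigma_sec H E \<inter> proj -` {(q2, p2)})"
  by (rule bij_betw_byWitness[where f' = "\<lambda>x. fst (snd x)"])
    (auto simp: Sigma_sec_def proj_def)

text \<open>A point lying over the complement of the discriminant is noncritical, so the local
  diffeomorphism provides the local inverse that a proper map needs to be a covering there.\<close>

lemma covering_map_proj:
  assumes C1: "C1_on UNIV H" and coe: "coercive H"
  shows "covering_map_with_multiplicity (Sigma_sec H E \<inter> proj -` (UNIV - discriminant H E)) proj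
    (UNIV - discriminant H E) (\<lambda>b. card (Sigma_sec H E \<inter> proj -` {b}))"
proof (rule covering_map_with_multiplicity_proper_local_homeomorphism
    [OF continuous_on_proj proper_map_proj[OF assms]])
  fix x assume x: "x \<in> Sigma_sec H E" "proj x \<in> UNIV - discriminant H E"
  then have x': "x \<in> Sigma_sec H E - Crit H E" by (auto simp: discriminant_def)
  obtain U where U: "x \<in> U" "openin (top_of_set (Sigma_sec H E - Crit H E)) U"
      "openin (top_of_set UNIV) (proj ` U)" "C1_diffeomorphism U (proj ` U) proj"
    using bspec[OF C1_local_diffeomorphism_proj[OF C1, unfolded C1_local_diffeomorphism_def] x']
    by blast
  have "openin (top_of_set (Sigma_sec H E)) (Sigma_sec H E - Crit H E)"
    using closed_Crit[OF C1, of E] by (metis Diff_eq open_Compl openin_open)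
  then have "openin (top_of_set (Sigma_sec H E)) U"
    using U(2) openin_trans by blast
  then show "\<exists>U g. x \<in> U \<and> openin (top_of_set (Sigma_sec H E)) U \<and> open (proj ` U) \<and>
      homeomorphism U (proj ` U) proj g"
    using U by (auto simp: C1_diffeomorphism_def)
qed

theorem theorem4p2:
  fixes H :: "real \<times> real \<times> real \<times> real \<Rightarrow> real" and E :: real
  assumes C1: "C1_on UNIV H"
  shows "C1_local_diffeomorphism (Sigma_sec H E - Crit H E) UNIV proj \<and>
    (coercive H \<longrightarrow> proper_map (top_of_set (Sigma_sec H E)) euclidean proj) \<and>
    (coercive H \<longrightarrow>
      (\<exists>m. covering_map_with_multiplicity
             (Sigma_sec H E \<inter> proj -` (UNIV - discriminant H E)) proj (UNIV - discriminant H E) m \<and>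
           locally (\<lambda>U. m constant_on U) (UNIV - discriminant H E) \<and>
           (\<forall>K \<in> components (UNIV - discriminant H E).
              m constant_on K \<and>
              (\<forall>(q2, p2) \<in> K. finite {p1. H (0, q2, p1, p2) = E} \<and>
                               m (q2, p2) = card {p1. H (0, q2, p1, p2) = E}))))"
proof (intro conjI impI)
  assume coe: "coercive H"
  define S where "S = UNIV - discriminant H E"
  define m where "m = (\<lambda>b. card (Sigma_sec H E \<inter> proj -` {b}))"
  have cov: "covering_map_with_multiplicity (Sigma_sec H E \<inter> proj -` S) proj S m"
    unfolding S_def m_def by (rule covering_map_proj[OF C1 coe])
  have loc: "locally (\<lambda>U. m constant_on U) S"
  proof (rule locallyI)
    fix w x assume w: "openin (top_of_set S) w" "x \<in> w"
    then have "x \<in> S" using openin_imp_subset by blast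
    then obtain T where T: "openin (top_of_set S) T" "x \<in> T" "\<forall>y\<in>T. m y = m x"
      using covering_map_with_multiplicity_locally_constant[OF cov \<open>x \<in> S\<close>] by blast
    \<comment> \<open>Intersecting with \<open>w\<close> places the neighbourhood of constancy
      inside the prescribed open set, as \<open>locally\<close> demands.\<close>
    then have "m constant_on (T \<inter> w)" unfolding constant_on_def by blast
    then show "\<exists>u v. openin (top_of_set S) u \<and> m constant_on v \<and> x \<in> u \<and> u \<subseteq> v \<and> v \<subseteq> w"
      using T w openin_Int[OF T(1) w(1)] by blast
  qed
  have const: "m constant_on K" if K: "K \<in> components S" for K
  proof (rule locally_constant_imp_constant)
    show "connected K" using K by (rule in_components_connected)
    fix a assume a: "a \<in> K"
    have KS: "K \<subseteq> S" using K by (rule in_components_subset)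
    then obtain T where T: "openin (top_of_set S) T" "a \<in> T" "\<forall>y\<in>T. m y = m a"
      using covering_map_with_multiplicity_locally_constant[OF cov subsetD[OF KS a]] by blast
    have "openin (top_of_set K) (K \<inter> T)"
      using T(1) KS by (auto simp: openin_open)
    then show "\<exists>T. openin (top_of_set K) T \<and> a \<in> T \<and> (\<forall>x\<in>T. m x = m a)"
      using T a by blast
  qed
  have fib: "finite {p1. H (0, q2, p1, p2) = E} \<and> m (q2, p2) = card {p1. H (0, q2, p1, p2) = E}"
    if "(q2, p2) \<in> S" for q2 p2
  proof -
    \<comment> \<open>The covering lives on the part of the section over \<open>S\<close>; for a
      base point in \<open>S\<close> this restriction leaves the fibre unchanged, so its size is the
      number of roots.\<close>
    have "Sigma_sec H E \<inter> proj -` S \<inter> proj -` {(q2, p2)} = Sigma_sec H E \<inter> proj -` {(q2, p2)}"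
      using that by auto
    then have "finite (Sigma_sec H E \<inter> proj -` {(q2, p2)})"
      using covering_map_with_multiplicity_fibre(1)[OF cov that] by simp
    then show ?thesis
      using bij_betw_finite[OF bij_betw_fibre_proj[of q2 p2 H E]]
        bij_betw_same_card[OF bij_betw_fibre_proj[of q2 p2 H E]]
      by (simp add: m_def)
  qed
  show "\<exists>m. covering_map_with_multiplicity
             (Sigma_sec H E \<inter> proj -` (UNIV - discriminant H E)) proj (UNIV - discriminant H E) m \<and>
           locally (\<lambda>U. m constant_on U) (UNIV - discriminant H E) \<and>
           (\<forall>K \<in> components (UNIV - discriminant H E).
              m constant_on K \<and>
              (\<forall>(q2, p2) \<in> K. finite {p1. H (0, q2, p1, p2) = E} \<and>
                               m (q2, p2) = card {p1. H (0, q2, p1, p2) = E}))"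
    unfolding S_def[symmetric]
  proof (intro exI[of _ m] conjI ballI cov loc)
    show "m constant_on K" if "K \<in> components S" for K
      using that by (rule const)
    fix K b assume K: "K \<in> components S" and b: "b \<in> K"
    then have "b \<in> S" using in_components_subset by blast
    then show "case b of (q2, p2) \<Rightarrow> finite {p1. H (0, q2, p1, p2) = E} \<and>
        m (q2, p2) = card {p1. H (0, q2, p1, p2) = E}"
      using fib by (cases b) simp
  qed
qed (rule C1_local_diffeomorphism_proj[OF C1], rule proper_map_proj[OF C1])

end
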